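(* Let $I=(\mathcal{E},D,c,f)$ be a CMP instance whose objective $f$ is of type sum, product, or bottleneck, and let $E=\{e_1,\dots,e_k\}\subseteq \mathcal{E}$ be an arbitrary subset. Then: (a) $\max_{l=1}^k u'_I(e_l)\le u'_I(E)$. (b) If $f$ is of type sum or product, the inequality $u'_I(E)\le \sum_{l=1}^k u'_I(e_l)$ does not hold in general; that is, for each of the two types (sum, and product) there exist a CMP instance $I$ of that type and a subset $E=\{e_1,\dots,e_k\}\subseteq\mathcal{E}$ with $u'_I(E)>\sum_{l=1}^k u'_I(e_l)$. (c) If $f$ is of type bottleneck, then $\sum_{l=1}^k u'_I(e_l)\le u'_I(E)$.
   Context: A combinatorial minimization problem (CMP) instance is $I=(\mathcal{E},D,c,f)$ where $\mathcal{E}$ is a finite ground set, $D\subseteq 2^{\mathcal{E}}\setminus\{\emptyset\}$ is a nonempty set of feasible solutions, $c:\mathcal{E}\to\mathbb{R}$ is a cost function, and $f:D\to\mathbb{R}$ is of one of three types: sum, $f(S)=\sum_{a\in S}c(a)$; product, $f(S)=\prod_{a\in S}c(a)$, where for this type all costs are positive; bottleneck, $f(S)=\max_{a\in S}c(a)$. An optimal solution is an $S^*\in D$ minimizing $f$; $D^*$ denotes the set of optimal solutions and $f(I)$ the optimal value. For $E=\{e_1,\dots,e_k\}\subseteq\mathcal{E}$ and $\vec\alpha=(\alpha_1,\dots,\alpha_k)\in\mathbb{R}^k$, $I_{\vec\alpha,E}=(\mathcal{E},D,c_{\vec\alpha,E},f_{\vec\alpha,E})$ is the instance with costs $c_{\vec\alpha,E}(e_l)=c(e_l)+\alpha_l$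 for $l=1,\dots,k$ and $c_{\vec\alpha,E}(a)=c(a)$ for $a\notin E$, and objective $f_{\vec\alpha,E}$ of the same type as $f$ computed with these costs; for a single element $e$ and $\alpha\in\mathbb{R}$ write $I_{\alpha,e}$. Values in $\mathbb{R}\cup\{\infty\}$ are allowed for tolerances; the supremum of an unbounded set is $\infty$. Single upper tolerance (for any $e\in\mathcal{E}$): $u'_I(e)=\sup\{\alpha\in\mathbb{R}_{\ge 0}\mid \text{every } S^*\in D^* \text{ is optimal for } I_{\alpha,e}\}$. Regular set upper tolerance (for any $E=\{e_1,\dots,e_k\}\subseteq\mathcal{E}$): $u'_I(E)=\sup\{\alpha\in\mathbb{R}\mid \text{for each } S^*\in D^* \text{ there exist } \alpha_1,\dots,\alpha_k\ge 0 \text{ with } \sum_{l=1}^k\alpha_l=\alpha \text{ such that } S^* \text{ is optimal for } I_{\vec\alpha,E}\}$. *)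

theory Defs
  imports "HOL-Library.Extended_Real"
begin

datatype objective_type = Sum_type | Product_type | Bottleneck_type

record 'a cmp =
  ground :: "'a set"
  feasible :: "'a set set"
  cost :: "'a \<Rightarrow> real"
  obj_type :: objective_type

definition is_cmp :: "'a cmp \<Rightarrow> bool" where
  "is_cmp I \<longleftrightarrow>
     finite (ground I) \<and>
     feasible I \<subseteq> Pow (ground I) - {{}} \<and>
     feasible I \<noteq> {} \<and>
     (obj_type I = Product_type \<longrightarrow> (\<forall>a\<in>ground I. 0 < cost I a))"

definition objective :: "'a cmp \<Rightarrow> 'a set \<Rightarrow> real" where
  "objective I S =
     (case obj_type I of
        Sum_type \<Rightarrow> \<Sum>a\<in>S. cost I a
      | Product_type \<Rightarrow> \<Prod>a\<in>S. cost I a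
      | Bottleneck_type \<Rightarrow> Max (cost I ` S))"

definition optimal_solutions :: "'a cmp \<Rightarrow> 'a set set" where
  "optimal_solutions I =
     {S \<in> feasible I. \<forall>T\<in>feasible I. objective I S \<le> objective I T}"

text \<open>
  A vector \<open>(\<alpha>\<^sub>1, \<dots>, \<alpha>\<^sub>k)\<close> attached to \<open>E = {e\<^sub>1, \<dots>, e\<^sub>k}\<close> is represented by a function on
  elements, with \<open>\<alpha> e\<^sub>l\<close> in place of \<open>\<alpha>\<^sub>l\<close>; its values outside \<open>E\<close> are irrelevant.
\<close>

definition perturb :: "'a cmp \<Rightarrow> ('a \<Rightarrow> real) \<Rightarrow> 'a set \<Rightarrow> 'a cmp" where
  "perturb I \<alpha> E = I\<lparr>cost := (\<lambda>a. if a \<in> E then cost I a + \<alpha> a else cost I a)\<rparr>"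

definition upper_tol :: "'a cmp \<Rightarrow> 'a \<Rightarrow> ereal" where
  "upper_tol I e =
     Sup (ereal ` {\<alpha>. 0 \<le> \<alpha> \<and>
       (\<forall>S\<in>optimal_solutions I. S \<in> optimal_solutions (perturb I (\<lambda>_. \<alpha>) {e}))})"

definition set_upper_tol :: "'a cmp \<Rightarrow> 'a set \<Rightarrow> ereal" where
  "set_upper_tol I E =
     Sup (ereal ` {\<alpha>. \<forall>S\<in>optimal_solutions I.
       \<exists>\<beta>. (\<forall>e\<in>E. 0 \<le> \<beta> e) \<and> (\<Sum>e\<in>E. \<beta> e) = \<alpha> \<and>
           S \<in> optimal_solutions (perturb I \<beta> E)})"

end

theory Submission
  imports Defs
begin

text \<open>
  (a) Put the whole increase on the single element. (b) Take two disjoint optimal solutions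
  \<open>{0}\<close> and \<open>{1}\<close> of equal cost: increasing either element destroys the optimality of its solution,
  so both single tolerances vanish, whereas the set tolerance allows the increase to be put, for each
  solution separately, on the element it does not contain. (c) If the maximum of a bottleneck
  solution is attained at an increased element, then it is already attained when only this element
  is increased, so increases that are tolerated one by one are tolerated simultaneously.
\<close>

lemma perturb_simps [simp]:
  "ground (perturb I \<beta> E) = ground I"
  "feasible (perturb I \<beta> E) = feasible I"
  "obj_type (perturb I \<beta> E) = obj_type I"
  "cost (perturb I \<beta> E) a = (if a \<in> E then cost I a + \<beta> a else cost I a)"
  by (simp_all add: perturb_def)

text \<open>Single tolerances perturb on \<open>{e}\<close>, the set tolerance on all of
  \<open>E\<close>; padding the increase with zeros yields the same cost function and so links the
  two.\<close>

lemma perturb_supported_singleton: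
  assumes "e \<in> E"
  shows "perturb I (\<lambda>a. if a = e then \<alpha> else 0) E = perturb I (\<lambda>_. \<alpha>) {e}"
  unfolding perturb_def by (rule arg_cong[where f = "\<lambda>c. I\<lparr>cost := c\<rparr>"]) (use assms in auto)

lemma perturb_zero: "perturb I (\<lambda>_. 0) E = I"
  by (rule cmp.equality) (simp_all add: fun_eq_iff)

lemma upper_tol_le_set_upper_tol:
  assumes "finite E" "e \<in> E"
  shows "upper_tol I e \<le> set_upper_tol I E"
  unfolding upper_tol_def set_upper_tol_def
proof (intro Sup_subset_mono image_mono subsetI CollectI ballI)
  fix \<alpha> S
  assume "\<alpha> \<in> {\<alpha>. 0 \<le> \<alpha> \<and>
       (\<forall>S\<in>optimal_solutions I. S \<in> optimal_solutions (perturb I (\<lambda>_. \<alpha>) {e}))}"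
    and "S \<in> optimal_solutions I"
  then show "\<exists>\<beta>. (\<forall>e\<in>E. 0 \<le> \<beta> e) \<and> (\<Sum>e\<in>E. \<beta> e) = \<alpha> \<and>
           S \<in> optimal_solutions (perturb I \<beta> E)"
    using assms
    by (intro exI[of _ "\<lambda>a. if a = e then \<alpha> else 0"]) (auto simp: perturb_supported_singleton)
qed

text \<open>Over nonempty sets of reals, suprema can be taken one summand at a time, so a bound on
  all sums of chosen members passes to the sum of the suprema. \<open>M\<close> stays arbitrary
  because the induction hypothesis is applied to \<open>M - ereal r\<close>.\<close>

lemma sum_Sup_ereal_le:
  fixes A :: "'b \<Rightarrow> real set" and M :: ereal
  assumes "finite E" "\<And>e. e \<in> E \<Longrightarrow> A e \<noteq> {}"
    and "\<And>g. (\<And>e. e \<in> E \<Longrightarrow> g e \<in> A e) \<Longrightarrow> ereal (\<Sum>e\<in>E. g e) \<le> M"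
  shows "(\<Sum>e\<in>E. Sup (ereal ` A e)) \<le> M"
  using assms
proof (induction E arbitrary: M rule: finite_induct)
  case empty
  then show ?case by (simp add: zero_ereal_def)
next
  case (insert x F)
  let ?s = "\<Sum>e\<in>F. Sup (ereal ` A e)"
  have shifted: "ereal r + ?s \<le> M" if r: "r \<in> A x" for r
  proof -
    have "?s \<le> M - ereal r"
    proof (rule insert.IH)
      fix g assume g: "\<And>e. e \<in> F \<Longrightarrow> g e \<in> A e"
      \<comment> \<open>A choice \<open>g\<close> on \<open>F\<close> is extended to
        \<open>x\<close> by the fixed member \<open>r\<close>, so the hypothesis for
        \<open>insert x F\<close> applies.\<close>
      have "ereal (\<Sum>e\<in>insert x F. (g(x := r)) e) \<le> M"
        using g r by (intro insert.prems(2)) auto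
      moreover have "(\<Sum>e\<in>F. (g(x := r)) e) = (\<Sum>e\<in>F. g e)"
        using insert.hyps by (intro sum.cong) auto
      ultimately show "ereal (\<Sum>e\<in>F. g e) \<le> M - ereal r"
        using insert.hyps by (simp add: ereal_le_minus add.commute)
    qed (use insert.prems in auto)
    then show ?thesis by (simp add: ereal_le_minus add.commute)
  qed
  \<comment> \<open>Moving \<open>?s\<close> inside the supremum over \<open>A x\<close> requires
    this; any choice of members bounds \<open>?s\<close> below by a real number.\<close>
  have "?s \<noteq> -\<infinity>"
  proof -
    define g where "g e = (SOME r. r \<in> A e)" for e
    have "g e \<in> A e" if "e \<in> F" for e
      unfolding g_def using insert.prems(1) that by (intro some_in_eq[THEN iffD2]) simp
    then have "(\<Sum>e\<in>F. ereal (g e)) \<le> ?s"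
      by (intro sum_mono Sup_upper imageI)
    then show ?thesis by force
  qed
  then have "Sup (ereal ` A x) + ?s = (SUP r\<in>A x. ereal r + ?s)"
    using insert.prems(1) by (subst SUP_ereal_add_left) simp_all
  also have "\<dots> \<le> M" using shifted by (rule SUP_least)
  finally show ?case using insert.hyps by simp
qed

lemma bottleneck_simultaneous_increase:
  assumes I: "is_cmp I" "obj_type I = Bottleneck_type"
    and S: "S \<in> optimal_solutions I"
    and \<beta>: "\<And>e. e \<in> E \<Longrightarrow> 0 \<le> \<beta> e"
    and single: "\<And>e. e \<in> E \<Longrightarrow> S \<in> optimal_solutions (perturb I (\<lambda>_. \<beta> e) {e})"
  shows "S \<in> optimal_solutions (perturb I \<beta> E)"
proof -
  have fin: "finite T" "T \<noteq> {}" if "T \<in> feasible I" for T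
    using I(1) that unfolding is_cmp_def by (blast intro: finite_subset)+
  have SF: "S \<in> feasible I" using S by (simp add: optimal_solutions_def)
  \<comment> \<open>Used below with \<open>J\<close> being \<open>I\<close> itself or
    \<open>I\<close> with a single element increased.\<close>
  have mono: "objective J T \<le> objective (perturb I \<beta> E) T"
    if "T \<in> feasible I" "obj_type J = Bottleneck_type"
      "\<And>a. cost J a \<le> cost (perturb I \<beta> E) a" for J T
  proof -
    have "cost J a \<le> Max (cost (perturb I \<beta> E) ` T)" if "a \<in> T" for a
      using that fin[OF \<open>T \<in> feasible I\<close>] \<open>cost J a \<le> cost (perturb I \<beta> E) a\<close>
      by (meson Max_ge finite_imageI imageI order_trans)
    then show ?thesis using that fin[of T] I(2) by (simp add: objective_def)
  qed
  have "objective (perturb I \<beta> E) S \<le> objective (perturb I \<beta> E) T" if T: "T \<in> feasible I" for T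
  proof -
    \<comment> \<open>Bounding the elements of \<open>S\<close> one at a time means that at most one
      increase matters for each bound: the one at \<open>a\<close>, or none if \<open>a\<close> lies
      outside \<open>E\<close>.\<close>
    have "cost (perturb I \<beta> E) a \<le> objective (perturb I \<beta> E) T" if a: "a \<in> S" for a
    proof (cases "a \<in> E")
      case True
      let ?J = "perturb I (\<lambda>_. \<beta> a) {a}"
      have "cost (perturb I \<beta> E) a = cost ?J a" using True by simp
      also have "\<dots> \<le> objective ?J S"
        using a fin[OF SF] I(2) by (simp add: objective_def del: perturb_simps(4))
      also have "\<dots> \<le> objective ?J T"
        using single[OF True] T by (simp add: optimal_solutions_def)
      also have "\<dots> \<le> objective (perturb I \<beta> E) T"
        using T I(2) True \<beta> by (intro mono) auto
      finally show ?thesis .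
    next
      case False
      then have "cost (perturb I \<beta> E) a = cost I a" by simp
      also have "\<dots> \<le> objective I S" using a fin[OF SF] I(2) by (simp add: objective_def)
      also have "\<dots> \<le> objective I T" using S T by (simp add: optimal_solutions_def)
      also have "\<dots> \<le> objective (perturb I \<beta> E) T"
        using T I(2) \<beta> by (intro mono) auto
      finally show ?thesis .
    qed
    then show ?thesis
      using fin[OF SF] I(2) by (subst objective_def) (simp del: perturb_simps(4))
  qed
  then show ?thesis using SF by (simp add: optimal_solutions_def)
qed

lemma bottleneck_sum_upper_tol_le:
  assumes "is_cmp I" "obj_type I = Bottleneck_type" "finite E"
  shows "(\<Sum>e\<in>E. upper_tol I e) \<le> set_upper_tol I E"
  unfolding upper_tol_def
proof (rule sum_Sup_ereal_le[OF \<open>finite E\<close>])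
  fix e
  show "{\<alpha>. 0 \<le> \<alpha> \<and> (\<forall>S\<in>optimal_solutions I.
      S \<in> optimal_solutions (perturb I (\<lambda>_. \<alpha>) {e}))} \<noteq> {}"
    by (auto simp: perturb_zero intro!: exI[of _ 0])
next
  fix g
  assume g: "\<And>e. e \<in> E \<Longrightarrow> g e \<in> {\<alpha>. 0 \<le> \<alpha> \<and> (\<forall>S\<in>optimal_solutions I.
      S \<in> optimal_solutions (perturb I (\<lambda>_. \<alpha>) {e}))}"
  \<comment> \<open>The one vector \<open>g\<close> serves all optimal solutions, although the set
    tolerance would allow a different vector for each.\<close>
  have "S \<in> optimal_solutions (perturb I g E)" if "S \<in> optimal_solutions I" for S
    by (rule bottleneck_simultaneous_increase[OF assms(1,2) that]) (use g that in simp_all)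
  then show "ereal (\<Sum>e\<in>E. g e) \<le> set_upper_tol I E"
    unfolding set_upper_tol_def 
    by (intro Sup_upper imageI CollectI ballI exI[of _ g] conjI refl) (use g in simp_all)
qed

text \<open>On singletons all three objective types reduce to the cost of the element, so one
  instance covers sum and product. Cost 1 meets the positivity condition of the product
  type.\<close>

definition two_singletons :: "objective_type \<Rightarrow> nat cmp" where
  "two_singletons t =
     \<lparr>ground = {0, 1}, feasible = {{0}, {1}}, cost = (\<lambda>_. 1), obj_type = t\<rparr>"

lemma two_singletons_simps [simp]:
  "ground (two_singletons t) = {0, 1}"
  "feasible (two_singletons t) = {{0}, {1}}"
  "cost (two_singletons t) a = 1"
  "obj_type (two_singletons t) = t"
  by (simp_all add: two_singletons_def)

lemma is_cmp_two_singletons: "is_cmp (two_singletons t)"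
  by (auto simp: is_cmp_def)

lemma objective_singleton [simp]: "objective I {a} = cost I a"
  by (simp add: objective_def split: objective_type.split)

lemma optimal_two_singletons: "optimal_solutions (two_singletons t) = {{0}, {1}}"
  by (auto simp: optimal_solutions_def)

lemma upper_tol_two_singletons:
  assumes "e \<in> {0, 1}"
  shows "upper_tol (two_singletons t) e \<le> 0"
  unfolding upper_tol_def
proof (rule Sup_least, elim imageE CollectE conjE)
  fix x \<alpha>
  assume x: "x = ereal \<alpha>"
    and opt: "\<forall>S\<in>optimal_solutions (two_singletons t).
      S \<in> optimal_solutions (perturb (two_singletons t) (\<lambda>_. \<alpha>) {e})"
  have "{e} \<in> optimal_solutions (perturb (two_singletons t) (\<lambda>_. \<alpha>) {e})"
    using opt assms by (simp add: optimal_two_singletons) blast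
  \<comment> \<open>On naturals \<open>1 - e\<close> swaps 0 and 1. The competing solution keeps
    cost 1 while \<open>{e}\<close> costs 1 + \<alpha>.\<close>
  moreover have "{1 - e} \<in> feasible (two_singletons t)" "1 - e \<noteq> e"
    using assms by auto
  ultimately have "\<alpha> \<le> 0"
    by (fastforce simp: optimal_solutions_def)
  then show "x \<le> 0" by (simp add: x)
qed

lemma set_upper_tol_two_singletons: "1 \<le> set_upper_tol (two_singletons t) {0, 1}"
proof -
  have "\<exists>\<beta>. (\<forall>e\<in>{0, 1}. 0 \<le> \<beta> e) \<and> (\<Sum>e\<in>{0, 1}. \<beta> e) = 1 \<and>
      S \<in> optimal_solutions (perturb (two_singletons t) \<beta> {0, 1})"
    if "S \<in> optimal_solutions (two_singletons t)" for S
    using that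
    \<comment> \<open>The whole unit goes on the element outside \<open>S\<close>, so
      \<open>S\<close> keeps cost 1 and its competitor rises to 2.\<close>
    by (intro exI[of _ "\<lambda>e. if e \<in> S then 0 else 1"])
      (auto simp: optimal_two_singletons optimal_solutions_def)
  then have "ereal 1 \<le> set_upper_tol (two_singletons t) {0, 1}"
    unfolding set_upper_tol_def by (intro Sup_upper imageI CollectI ballI)
  then show ?thesis by (simp add: one_ereal_def)
qed

lemma sum_upper_tol_less_two_singletons:
  "(\<Sum>e\<in>{0, 1}. upper_tol (two_singletons t) e) < set_upper_tol (two_singletons t) {0, 1}"
proof -
  have "(\<Sum>e\<in>{0, 1}. upper_tol (two_singletons t) e) \<le> 0"
    using upper_tol_two_singletons by (rule sum_nonpos)
  also have "(0 :: ereal) < 1" by simp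
  also note set_upper_tol_two_singletons
  finally show ?thesis .
qed

text \<open>The guard on \<open>E\<close> in the first part reflects that \<open>Max\<close> is
  unspecified on the empty set. The instances in the second part live on \<open>nat\<close> because
  types cannot be existentially quantified.\<close>

theorem theorem1:
  fixes I :: "'a cmp" and E :: "'a set"
  assumes "is_cmp I" and "E \<subseteq> ground I"
  shows "(E \<noteq> {} \<longrightarrow> Max (upper_tol I ` E) \<le> set_upper_tol I E) \<and>
    (\<forall>t\<in>{Sum_type, Product_type}. \<exists>(J :: nat cmp) F.
        is_cmp J \<and> obj_type J = t \<and> F \<subseteq> ground J \<and>
        set_upper_tol J F > (\<Sum>e\<in>F. upper_tol J e)) \<and>
    (obj_type I = Bottleneck_type \<longrightarrow> (\<Sum>e\<in>E. upper_tol I e) \<le> set_upper_tol I E)"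
proof (intro conjI impI ballI)
  have fin: "finite E" using assms by (auto simp: is_cmp_def intro: finite_subset)
  show "Max (upper_tol I ` E) \<le> set_upper_tol I E" if "E \<noteq> {}"
    using that fin by (simp add: upper_tol_le_set_upper_tol)
  show "\<exists>(J :: nat cmp) F. is_cmp J \<and> obj_type J = t \<and> F \<subseteq> ground J \<and>
      set_upper_tol J F > (\<Sum>e\<in>F. upper_tol J e)" for t
    using is_cmp_two_singletons sum_upper_tol_less_two_singletons
    by (intro exI[of _ "two_singletons t"] exI[of _ "{0, 1}"]) simp
  show "(\<Sum>e\<in>E. upper_tol I e) \<le> set_upper_tol I E" if "obj_type I = Bottleneck_type"
    using assms(1) that fin by (rule bottleneck_sum_upper_tol_le)
qed

end
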